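(* Let $A=\{p,q\}\subset\mathbb{N}$ with $1<p<q$ and $\gcd(p,q)=1$. Then $\overline{\rho}(A)=\overline{\sigma}(A)$.
   Context: A set $S$ of positive integers is $A$-quotient-free if there are no $x,y\in S$ with $x/y\in A$. For $X>0$ let $[X]=\{k\in\mathbb{N}:k\le X\}$, and for $S\subseteq\mathbb{N}$ let $\overline{\delta}(S)=\limsup_{X\to\infty}|S\cap[X]|/X$. $\overline{\rho}(A)$ is the supremum of $\overline{\delta}(S)$ over all $A$-quotient-free sets $S$. Let $m_1<m_2<\cdots$ be the increasing enumeration of all integers of the form $p^xq^y$ with $x,y\in\mathbb{Z}_{\ge0}$ (so $m_1=1$; each $m_i=p^{x_i}q^{y_i}$ with unique exponents). For $j\in\{0,1\}$ and $t\ge1$ let $A_j(t)=\{m_i: 1\le i\le t,\ x_i+y_i\equiv j\pmod 2\}$. Define $$\overline{\sigma}(A)=\left(1-\frac1p\right)\left(1-\frac1q\right)\sum_{t=1}^\infty\max\big(|A_0(t)|,|A_1(t)|\big)\left(\frac1{m_t}-\frac1{m_{t+1}}\right).$$ *)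

theory Defs
  imports "HOL-Library.Extended_Real" "HOL-Library.Infinite_Set" "HOL-Number_Theory.Cong"
begin

definition quotient_free :: "nat set \<Rightarrow> nat set \<Rightarrow> bool" where
  "quotient_free A S \<longleftrightarrow>
     (\<forall>x\<in>S. 0 < x) \<and> \<not> (\<exists>x\<in>S. \<exists>y\<in>S. real x / real y \<in> real ` A)"

definition initial_segment :: "real \<Rightarrow> nat set" where
  "initial_segment X = {k. 0 < k \<and> real k \<le> X}"

definition upper_density :: "nat set \<Rightarrow> ereal" where
  "upper_density S =
     Limsup at_top (\<lambda>X::real. ereal (real (card (S \<inter> initial_segment X)) / X))"

definition upper_rho :: "nat set \<Rightarrow> ereal" where
  "upper_rho A = (SUP S \<in> {S. quotient_free A S}. upper_density S)"

definition power_products :: "nat \<Rightarrow> nat \<Rightarrow> nat set" where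
  "power_products p q = {p ^ x * q ^ y | x y. True}"

text \<open>The enumeration is indexed from 1 (so that the first element is 1), whereas
  \<^const>\<open>enumerate\<close> starts at 0. The index 0 is never used below.\<close>

definition m_seq :: "nat \<Rightarrow> nat \<Rightarrow> nat \<Rightarrow> nat" where
  "m_seq p q i = enumerate (power_products p q) (i - 1)"

text \<open>For coprime \<open>p, q > 1\<close> the exponents \<open>x, y\<close> of an element are
  unique, so the existential quantification over them below just names them.\<close>

definition parity_class :: "nat \<Rightarrow> nat \<Rightarrow> nat \<Rightarrow> nat \<Rightarrow> nat set" where
  "parity_class p q j t =
     {m_seq p q i | i. 1 \<le> i \<and> i \<le> t \<and>
        (\<exists>x y. m_seq p q i = p ^ x * q ^ y \<and> [x + y = j] (mod 2))}"

text \<open>The series over \<open>t \<ge> 1\<close> is written with \<open>Suc t\<close> in place of \<open>t\<close>. Its terms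
  are nonnegative, so taking it in \<^typ>\<open>ereal\<close> gives it a value without presupposing
  convergence.\<close>

definition upper_sigma :: "nat \<Rightarrow> nat \<Rightarrow> ereal" where
  "upper_sigma p q =
     ereal ((1 - 1 / real p) * (1 - 1 / real q)) *
     (\<Sum>t. ereal
        (real (max (card (parity_class p q 0 (Suc t))) (card (parity_class p q 1 (Suc t)))) *
         (1 / real (m_seq p q (Suc t)) - 1 / real (m_seq p q (Suc (Suc t))))))"

end

theory Submission imports Defs "HOL-Analysis.Uniform_Limit" begin

text \<open>Every positive integer is uniquely \<open>k p\<^sup>x q\<^sup>y\<close> with \<open>k\<close> divisible by neither \<open>p\<close> nor \<open>q\<close>, so a
  quotient-free set restricted to \<open>[N]\<close> is, for each \<open>k \<le> N\<close>, an independent set of the grid graph on the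
  staircase \<open>p\<^sup>x q\<^sup>y \<le> N / k\<close>. Cut the staircase into layers \<open>x + y = s\<close>. As \<open>p < q\<close>, the layers are full
  up to some \<open>s\<close>, and from then on each layer embeds into the previous one by \<open>x \<mapsto> x - 1\<close>. Counting
  the independent set layer by layer shows that one of the two parity classes of \<open>x + y\<close> is optimal.
  Summing over \<open>k\<close> and applying Tannery's theorem yields the density \<open>\<sigma>\<close> as an upper bound. It is
  attained along the sequence \<open>N = n!\<close> by choosing the optimal parity classes in blocks that are so
  sparse that everything before the current block is negligible.\<close>

section \<open>Independent sets in a sheared staircase\<close>

lemma card_eq_sum_fibers:
  fixes f :: "'a \<Rightarrow> nat"
  assumes "finite A" and "\<And>c. c \<in> A \<Longrightarrow> f c < N"
  shows "card A = (\<Sum>s<N. card {c \<in> A. f c = s})"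
  using sum.group[of A "{..<N}" f "\<lambda>_. 1::nat"] assms by (simp add: image_subset_iff)

text \<open>Models the cells with \<open>p^x * q^y\<close> at most a bound: \<open>left\<close> is
  division by \<open>p\<close>, and \<open>shear\<close> trades a factor \<open>q\<close> for the
  smaller \<open>p\<close>.\<close>

locale staircase =
  fixes R :: "(nat \<times> nat) set"
  assumes finite_R: "finite R"
    and left: "(Suc x, y) \<in> R \<Longrightarrow> (x, y) \<in> R"
    and shear: "(x, Suc y) \<in> R \<Longrightarrow> (Suc x, y) \<in> R"
begin

definition layer :: "nat \<Rightarrow> (nat \<times> nat) set" where
  "layer s = {c \<in> R. fst c + snd c = s}"

lemma finite_layer: "finite (layer s)"
  using finite_R by (simp add: layer_def)

lemma down: "(x, Suc y) \<in> R \<Longrightarrow> (x, y) \<in> R"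
  using shear left by blast

lemma shear_many: "(x, y + k) \<in> R \<Longrightarrow> (x + k, y) \<in> R"
proof (induction k arbitrary: x)
  case (Suc k)
  from Suc.prems have "(Suc x, y + k) \<in> R" using shear by simp
  from Suc.IH[OF this] show ?case by simp
qed simp

lemma full_layer:
  assumes "(0, s) \<in> R"
  shows "layer s = (\<lambda>y. (s - y, y)) ` {..s}"
proof -
  have "(s - y, y) \<in> R" if "y \<le> s" for y
    using shear_many[of 0 y "s - y"] assms that by simp
  moreover have "c = (s - snd c, snd c) \<and> snd c \<le> s" if "fst c + snd c = s" for c :: "nat \<times> nat"
    using that by (cases c) auto
  ultimately show ?thesis unfolding layer_def by fastforce
qed

lemma card_full_layer:
  assumes "(0, s) \<in> R"
  shows "card (layer s) = Suc s"
proof -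
  have "inj_on (\<lambda>y. (s - y, y)) {..s}" by (auto intro: inj_onI)
  then show ?thesis unfolding full_layer[OF assms] by (simp add: card_image)
qed

text \<open>Full layers grow by one cell per step, so their alternating sum stays between 0 and
  \<open>s\<close>. The upper bound strengthens the induction: each inequality at
  \<open>Suc s\<close> follows from the other one at \<open>s\<close>.\<close>

lemma ascending_alternating_sums:
  fixes S :: "bool \<Rightarrow> nat \<Rightarrow> nat"
  assumes S: "\<And>s. S True (Suc s) = S False s"
      "\<And>s. S False (Suc s) = card (layer s) + S True s"
    and 0: "S True 0 = 0" "S False 0 = 0" and "(0, s) \<in> R"
  shows "S True s \<le> S False s \<and> S False s \<le> S True s + s"
  using assms(5)
proof (induction s)
  case (Suc s)
  then have s: "(0, s) \<in> R" by (rule_tac down)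
  show ?case using Suc.IH[OF s] S[of s] card_full_layer[OF s] by simp
qed (simp add: 0)

end

section \<open>Optimality of the parity classes in a staircase\<close>

locale independent_staircase = staircase +
  fixes I :: "(nat \<times> nat) set"
  assumes I_sub: "I \<subseteq> R"
    and independent: "(x, y) \<in> I \<Longrightarrow> (Suc x, y) \<notin> I" "(x, y) \<in> I \<Longrightarrow> (x, Suc y) \<notin> I"
begin

lemma card_two_layers:
  assumes "inj_on f (I \<inter> layer (Suc s))" and "f ` (I \<inter> layer (Suc s)) \<subseteq> layer s - I"
  shows "card (I \<inter> layer s) + card (I \<inter> layer (Suc s)) \<le> card (layer s)"
proof -
  have "card (I \<inter> layer (Suc s)) \<le> card (layer s - I)"
    using assms finite_layer by (intro card_inj_on_le) auto
  moreover have "card (layer s) = card (layer s \<inter> I) + card (layer s - I)"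
    using finite_layer card_Int_Diff by blast
  ultimately show ?thesis by (simp add: Int_commute)
qed

text \<open>A layer without its cell on the axis is matched into the previous one by moving left. A
  full layer has one cell more than its predecessor, so a matching needs a cell missing from
  \<open>I\<close>; if there is none, \<open>I\<close> has to avoid layer \<open>s\<close>.\<close>

lemma two_layers:
  "card (I \<inter> layer s) + card (I \<inter> layer (Suc s)) \<le> card (layer s) \<or>
   (card (I \<inter> layer s) = 0 \<and> (0, s) \<in> R)"
proof (cases "(0, Suc s) \<in> R")
  case False
  let ?f = "\<lambda>c :: nat \<times> nat. (fst c - 1, snd c)"
  \<comment> \<open>Only \<open>(0, Suc s)\<close> could lack a left neighbour.\<close>
  have pos: "fst c > 0" if "c \<in> layer (Suc s)" for c
    using that False by (cases c; cases "fst c") (auto simp: layer_def)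
  have inj: "inj_on ?f (I \<inter> layer (Suc s))"
  proof (rule inj_onI)
    fix c c' assume c: "c \<in> I \<inter> layer (Suc s)" "c' \<in> I \<inter> layer (Suc s)" and e: "?f c = ?f c'"
    show "c = c'" using e pos[of c] pos[of c'] c by (auto simp: prod_eq_iff)
  qed
  have sub: "?f ` (I \<inter> layer (Suc s)) \<subseteq> layer s - I"
  proof (rule image_subsetI)
    fix c assume c: "c \<in> I \<inter> layer (Suc s)"
    then obtain x y where "c = (Suc x, y)" using pos[of c] by (metis IntD2 gr0_implies_Suc prod.collapse)
    then show "?f c \<in> layer s - I" using c left independent(1)[of x y] by (auto simp: layer_def)
  qed
  show ?thesis using card_two_layers[OF inj sub] by simp
next
  case top: True
  show ?thesis
  proof (cases "layer (Suc s) \<subseteq> I")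
    case True
    \<comment> \<open>The right neighbour of every cell of layer \<open>s\<close> lies in the full
      layer \<open>Suc s\<close>, hence in \<open>I\<close>.\<close>
    have "c \<notin> I" if "c \<in> layer s" for c
    proof -
      obtain x y where xy: "c = (x, y)" by fastforce
      have "(Suc x, y) \<in> layer (Suc s)"
        using that unfolding full_layer[OF top] xy by (auto simp: layer_def image_iff)
      then show ?thesis using True independent(1) xy by blast
    qed
    then have "I \<inter> layer s = {}" by blast
    then show ?thesis using down[OF top] by simp
  next
    case False
    then obtain u w where uw: "(u, w) \<in> layer (Suc s)" "(u, w) \<notin> I" by auto
    text \<open>The missing cell splits the layer into a part matched left and a part matched down.\<close>
    let ?f = "\<lambda>c :: nat \<times> nat. if snd c < w then (fst c - 1, snd c) else (fst c, snd c - 1)"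
    have split: "(snd c < w \<and> fst c > 0) \<or> snd c > w" if "c \<in> I \<inter> layer (Suc s)" for c
    proof (rule ccontr)
      assume "\<not> ?thesis"
      then have "snd c = w" using that uw by (auto simp: layer_def)
      then have "c = (u, w)" using that uw by (cases c) (auto simp: layer_def)
      then show False using that uw by simp
    qed
    \<comment> \<open>Left moves keep the second coordinate below \<open>w\<close>; down moves start
      above \<open>w\<close> and end at \<open>w\<close> or higher.\<close>
    have inj: "inj_on ?f (I \<inter> layer (Suc s))"
    proof (rule inj_onI)
      fix c c' assume c: "c \<in> I \<inter> layer (Suc s)" "c' \<in> I \<inter> layer (Suc s)" and e: "?f c = ?f c'"
      have "fst c + snd c = Suc s" "fst c' + snd c' = Suc s" using c by (auto simp: layer_def)
      then show "c = c'" using e split[OF c(1)] split[OF c(2)]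
        by (auto simp: prod_eq_iff split: if_splits)
    qed
    have sub: "?f ` (I \<inter> layer (Suc s)) \<subseteq> layer s - I"
    proof (rule image_subsetI)
      fix c assume c: "c \<in> I \<inter> layer (Suc s)"
      show "?f c \<in> layer s - I"
      proof (cases "snd c < w")
        case True
        then obtain x y where "c = (Suc x, y)"
          using split[OF c] by (metis gr0_implies_Suc less_asym prod.collapse)
        then show ?thesis using c True left independent(1)[of x y] by (auto simp: layer_def)
      next
        case False
        then obtain x y where "c = (x, Suc y)"
          using split[OF c] by (metis gr0_implies_Suc gr_implies_not_zero not_gr_zero prod.collapse)
        then show ?thesis using c False down independent(2)[of x y] by (auto simp: layer_def)
      qed
    qed
    show ?thesis using card_two_layers[OF inj sub] by simp
  qed
qed

lemma card_independent_le:
  "card I \<le> max (card {c \<in> R. even (fst c + snd c)}) (card {c \<in> R. odd (fst c + snd c)})"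
proof -
  define a where "a = (\<lambda>s. card (I \<inter> layer s))"
  \<comment> \<open>Parity is taken relative to \<open>s\<close>, so passing to \<open>Suc s\<close>
    swaps the two sums.\<close>
  define S where "S = (\<lambda>b s. \<Sum>i | i < s \<and> even (i + s) = b. card (layer i))"
  obtain N where N: "\<And>c. c \<in> R \<Longrightarrow> fst c + snd c < N"
    using finite_nat_bounded[OF finite_imageI[OF finite_R, of "\<lambda>c. fst c + snd c"]] by blast
  have fI: "finite I" using I_sub finite_R by (rule finite_subset)
  have alt: "S True (Suc s) = S False s" "S False (Suc s) = card (layer s) + S True s" for s
  proof -
    show "S True (Suc s) = S False s"
      unfolding S_def by (rule sum.cong) (auto simp: less_Suc_eq)
    have "{i. i < Suc s \<and> even (i + Suc s) = False} = insert s {i. i < s \<and> even (i + s) = True}"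
      by (auto simp: less_Suc_eq)
    then show "S False (Suc s) = card (layer s) + S True s" unfolding S_def by simp
  qed
  \<comment> \<open>The alternatives feed each other: the first at \<open>s\<close> is the second at
    \<open>Suc s\<close>, and the second at \<open>s\<close> with the two-layer bound gives the
    first at \<open>Suc s\<close>. In the exceptional case \<open>a s = 0\<close>, and the ascending
    sums preserve the second.\<close>
  have invariant: "(\<Sum>i<s. a i) + a s \<le> S False s \<or> (\<Sum>i<s. a i) \<le> S True s" for s
  proof (induction s)
    case (Suc s)
    have "S True s \<le> S False s" if "(0, s) \<in> R"
      using ascending_alternating_sums[of S s] alt that by (simp add: S_def)
    then have "a s + a (Suc s) \<le> card (layer s) \<or> (a s = 0 \<and> S True s \<le> S False s)"
      using two_layers[of s] by (auto simp: a_def)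
    then show ?case using Suc alt[of s] by auto
  qed simp
  have parity: "card {c \<in> R. even (fst c + snd c + N) = b} = S b N" for b
  proof -
    have "card {c \<in> R. even (fst c + snd c + N) = b}
      = (\<Sum>s<N. card {c \<in> {c \<in> R. even (fst c + snd c + N) = b}. fst c + snd c = s})"
      using finite_R N by (intro card_eq_sum_fibers) auto
    also have "\<dots> = (\<Sum>s<N. if even (s + N) = b then card (layer s) else 0)"
    proof (rule sum.cong[OF refl])
      fix s
      have "{c \<in> {c \<in> R. even (fst c + snd c + N) = b}. fst c + snd c = s}
        = (if even (s + N) = b then layer s else {})" by (auto simp: layer_def simp del: even_add)
      then show "card {c \<in> {c \<in> R. even (fst c + snd c + N) = b}. fst c + snd c = s}
        = (if even (s + N) = b then card (layer s) else 0)" by (simp del: even_add)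
    qed
    also have "\<dots> = (\<Sum>s \<in> {s \<in> {..<N}. even (s + N) = b}. card (layer s))"
      by (rule sum.inter_filter[symmetric]) simp
    finally show ?thesis by (simp add: S_def)
  qed
  have "card I = (\<Sum>s<N. card {c \<in> I. fst c + snd c = s})"
    using fI N I_sub by (intro card_eq_sum_fibers) auto
  also have "\<dots> = (\<Sum>s<N. a s)"
    using I_sub by (intro sum.cong) (auto simp: a_def layer_def intro!: arg_cong[where f = card])
  also have "\<dots> \<le> max (S True N) (S False N)" using invariant[of N] by auto
  also have "\<dots> = max (card {c \<in> R. even (fst c + snd c)}) (card {c \<in> R. odd (fst c + snd c)})"
    using parity[of True] parity[of False] by (cases "even N") (auto simp: max.commute)
  finally show ?thesis .
qed

end

section \<open>Decomposition of the positive integers into grids\<close>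

lemma power_mult_cancel:
  fixes p :: nat
  assumes "p ^ x * u = p ^ x' * u'" and "\<not> p dvd u" and "\<not> p dvd u'" and "0 < p"
  shows "x = x' \<and> u = u'"
  using assms(1)
proof (induction x arbitrary: x')
  case 0
  then show ?case using assms(2) by (cases x') auto
next
  case (Suc x)
  show ?case
  proof (cases x')
    case 0
    then have "u' = p * (p ^ x * u)" using Suc.prems by simp
    then show ?thesis using assms(3) by simp
  next
    case (Suc z)
    then show ?thesis using Suc.IH[of z] Suc.prems assms(4) by simp
  qed
qed

lemma card_multiples:
  assumes "0 < (r::nat)"
  shows "card {k \<in> {1..n}. r dvd k} = n div r"
proof -
  have "{k \<in> {1..n}. r dvd k} = (*) r ` {1..n div r}"
  proof (intro set_eqI iffI)
    fix k assume k: "k \<in> {k \<in> {1..n}. r dvd k}"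
    then obtain j where "k = r * j" by auto
    then show "k \<in> (*) r ` {1..n div r}"
      using k assms by (auto simp: less_eq_div_iff_mult_less_eq mult.commute)
  qed (use assms in \<open>auto simp: less_eq_div_iff_mult_less_eq mult.commute\<close>)
  then show ?thesis using assms by (simp add: card_image inj_on_def)
qed

lemma tannery:
  fixes a :: "nat \<Rightarrow> nat \<Rightarrow> real"
  assumes "\<And>k. (\<lambda>n. a k n) \<longlonglongrightarrow> b k" and "\<And>k n. norm (a k n) \<le> M k" and "summable M"
  shows "(\<lambda>n. \<Sum>k. a k n) \<longlonglongrightarrow> (\<Sum>k. b k)"
  using tannerys_theorem[of a b sequentially M] assms by (simp add: always_eventually split_def)

lemma real_div_bounds:
  "real (n div r) \<le> real n / real r" "real n / real r - 1 \<le> real (n div r)"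
  using floor_divide_of_nat_eq[of n r, where ?'a = real] of_int_floor_le[of "real n / real r"]
    real_of_int_floor_ge_diff_one[of "real n / real r"] by simp_all

locale coprime_bases =
  fixes p q :: nat
  assumes p_gt_1: "1 < p" and p_less_q: "p < q" and coprime: "coprime p q"
begin

lemma q_gt_1: "1 < q"
  using p_gt_1 p_less_q by simp

definition val :: "nat \<times> nat \<Rightarrow> nat" where
  "val c = p ^ fst c * q ^ snd c"

text \<open>Since \<open>p\<close> and \<open>q\<close> need not be prime, this is weaker than being coprime to \<open>p q\<close>.\<close>

definition core :: "nat set" where
  "core = {k. \<not> p dvd k \<and> \<not> q dvd k}"

lemma core_pos: "k \<in> core \<Longrightarrow> 0 < k"
  by (cases k) (auto simp: core_def)

lemma val_pos: "0 < val c"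
  using p_gt_1 p_less_q by (simp add: val_def)

lemma val_Suc: "val (Suc x, y) = p * val (x, y)" "val (x, Suc y) = q * val (x, y)"
  by (simp_all add: val_def)

text \<open>The power of \<open>p\<close> is stripped first, since by coprimality \<open>p\<close>
  does not divide \<open>q ^ y * k\<close>; then the power of \<open>q\<close>.\<close>

lemma core_val_unique:
  assumes "k * val c = k' * val c'" and "k \<in> core" and "k' \<in> core"
  shows "k = k' \<and> c = c'"
proof -
  have not_p: "\<not> p dvd q ^ y * k" if "k \<in> core" for y k
    using that coprime by (auto simp: core_def coprime_dvd_mult_right_iff)
  have "p ^ fst c * (q ^ snd c * k) = p ^ fst c' * (q ^ snd c' * k')"
    using assms(1) by (simp add: val_def mult_ac)
  then have 1: "fst c = fst c'" "q ^ snd c * k = q ^ snd c' * k'"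
    using power_mult_cancel not_p assms(2,3) p_gt_1 by (metis gr_implies_not_zero not_gr_zero)+
  then show ?thesis
    using power_mult_cancel[OF 1(2)] assms(2,3) q_gt_1 by (auto simp: core_def prod_eq_iff)
qed

lemma core_val_exists: "0 < n \<Longrightarrow> \<exists>k\<in>core. \<exists>c. n = k * val c"
proof (induction n rule: less_induct)
  case (less n)
  consider "n \<in> core" | "p dvd n" | "q dvd n" by (auto simp: core_def)
  then show ?case
  proof cases
    case 1
    then show ?thesis by (intro bexI[of _ n] exI[of _ "(0, 0)"]) (simp_all add: val_def)
  next
    case 2
    then obtain n' where n': "n = p * n'" by auto
    then have "n' < n" "0 < n'" using less.prems p_gt_1 by auto
    from less.IH[OF this] obtain k x y where "k \<in> core" "n' = k * val (x, y)" by fastforce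
    then show ?thesis using n' by (intro bexI[of _ k] exI[of _ "(Suc x, y)"]) (simp_all add: val_Suc)
  next
    case 3
    then obtain n' where n': "n = q * n'" by auto
    then have "n' < n" "0 < n'" using less.prems q_gt_1 by auto
    from less.IH[OF this] obtain k x y where "k \<in> core" "n' = k * val (x, y)" by fastforce
    then show ?thesis using n' by (intro bexI[of _ k] exI[of _ "(x, Suc y)"]) (simp_all add: val_Suc)
  qed
qed

section \<open>Staircases of cells of bounded value, and the count over all grids\<close>

definition region :: "nat \<Rightarrow> (nat \<times> nat) set" where
  "region Z = {c. val c \<le> Z}"

text \<open>A crude box, enough for finiteness and for a later comparison with two geometric
  series.\<close>

lemma region_subset: "region Z \<subseteq> {..Z} \<times> {..Z}"
proof
  fix c assume "c \<in> region Z"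
  then have le: "p ^ fst c * q ^ snd c \<le> Z" by (simp add: region_def val_def)
  have "fst c < p ^ fst c" "snd c < q ^ snd c" using p_gt_1 q_gt_1 by (simp_all add: power_gt_expt)
  moreover have "p ^ fst c \<le> p ^ fst c * q ^ snd c" "q ^ snd c \<le> p ^ fst c * q ^ snd c"
    using p_gt_1 q_gt_1 by simp_all
  ultimately have "fst c \<le> Z" "snd c \<le> Z" using le by linarith+
  then show "c \<in> {..Z} \<times> {..Z}" by (simp add: mem_Times_iff)
qed

lemma finite_region: "finite (region Z)"
  using region_subset by (rule finite_subset) simp

lemma region_mono: "Y \<le> Z \<Longrightarrow> region Y \<subseteq> region Z"
  by (auto simp: region_def)

lemma staircase_region: "staircase (region Z)"
proof
  fix x y
  show "(x, y) \<in> region Z" if "(Suc x, y) \<in> region Z"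
  proof -
    have "val (x, y) \<le> p * val (x, y)" using p_gt_1 by simp
    then show ?thesis using that unfolding region_def mem_Collect_eq val_Suc by (rule le_trans)
  qed
  show "(Suc x, y) \<in> region Z" if "(x, Suc y) \<in> region Z"
  proof -
    have "p * val (x, y) \<le> q * val (x, y)" using p_less_q by simp
    then show ?thesis using that unfolding region_def mem_Collect_eq val_Suc by (rule le_trans)
  qed
qed (rule finite_region)

definition parity_region :: "bool \<Rightarrow> nat \<Rightarrow> (nat \<times> nat) set" where
  "parity_region b Z = {c \<in> region Z. even (fst c + snd c) = b}"

lemma finite_parity_region: "finite (parity_region b Z)"
  using finite_region by (simp add: parity_region_def)

definition gain :: "nat \<Rightarrow> nat" where
  "gain Z = max (card (parity_region True Z)) (card (parity_region False Z))"

definition grid_total :: "nat \<Rightarrow> nat" where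
  "grid_total N = (\<Sum>k \<in> core \<inter> {..N}. gain (N div k))"

text \<open>Sorts the members of \<open>S\<close> by their unique factor in
  \<open>core\<close>.\<close>

lemma card_by_grids:
  "card (S \<inter> {1..N}) = (\<Sum>k \<in> core \<inter> {..N}. card {c \<in> region (N div k). k * val c \<in> S})"
proof -
  let ?A = "SIGMA k : core \<inter> {..N}. {c \<in> region (N div k). k * val c \<in> S}"
  have le: "val c \<le> N div k \<longleftrightarrow> k * val c \<le> N" if "k \<in> core" for k c
    using core_pos[OF that] by (simp add: less_eq_div_iff_mult_less_eq mult.commute)
  have "bij_betw (\<lambda>(k, c). k * val c) ?A (S \<inter> {1..N})"
  proof (rule bij_betw_imageI)
    show "inj_on (\<lambda>(k, c). k * val c) ?A"
      unfolding inj_on_def using core_val_unique by fast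
    show "(\<lambda>(k, c). k * val c) ` ?A = S \<inter> {1..N}"
    proof (intro set_eqI iffI)
      fix v assume "v \<in> (\<lambda>(k, c). k * val c) ` ?A"
      then obtain k c where kc: "v = k * val c" "k \<in> core" "c \<in> region (N div k)" "k * val c \<in> S"
        by auto
      have "v \<le> N" using kc le by (simp add: region_def)
      moreover have "0 < v" using kc core_pos val_pos by simp
      ultimately show "v \<in> S \<inter> {1..N}" using kc by simp
    next
      fix v assume v: "v \<in> S \<inter> {1..N}"
      then obtain k c where kc: "k \<in> core" "v = k * val c" using core_val_exists[of v] by auto
      have "k * 1 \<le> k * val c" using val_pos[of c] by (intro mult_le_mono2) simp
      then have "k \<le> N" using v kc by (metis IntD2 atLeastAtMost_iff le_trans nat_mult_1_right)
      then have "(k, c) \<in> ?A" using v kc le[of k c] by (simp add: region_def)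
      then show "v \<in> (\<lambda>(k, c). k * val c) ` ?A" using kc by force
    qed
  qed
  then have "card ?A = card (S \<inter> {1..N})" by (rule bij_betw_same_card)
  moreover have "card ?A = (\<Sum>k \<in> core \<inter> {..N}. card {c \<in> region (N div k). k * val c \<in> S})"
    using finite_region by (intro card_SigmaI) auto
  ultimately show ?thesis by simp
qed

lemma quotient_freeD:
  assumes "quotient_free {p, q} S" and "v \<in> S"
  shows "p * v \<notin> S" and "q * v \<notin> S"
proof -
  \<comment> \<open>Members of \<open>S\<close> are positive, so this is not a division by
    zero.\<close>
  have "real (r * v) / real v = real r" for r
    using assms by (auto simp: quotient_free_def)
  then show "p * v \<notin> S" "q * v \<notin> S"
    using assms unfolding quotient_free_def by (metis imageI insertCI)+
qed

text \<open>Neighbouring cells of a grid differ by a factor \<open>p\<close> or \<open>q\<close>, so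
  \<open>S\<close> is independent on each grid and the staircase bound applies.\<close>

lemma card_quotient_free_le:
  assumes "quotient_free {p, q} S"
  shows "card (S \<inter> {1..N}) \<le> grid_total N"
  unfolding card_by_grids grid_total_def
proof (rule sum_mono)
  fix k
  let ?I = "{c \<in> region (N div k). k * val c \<in> S}"
  interpret staircase "region (N div k)" by (rule staircase_region)
  interpret independent_staircase "region (N div k)" ?I
  proof
    fix x y assume "(x, y) \<in> ?I"
    then show "(Suc x, y) \<notin> ?I" "(x, Suc y) \<notin> ?I"
      using quotient_freeD[OF assms, of "k * val (x, y)"] by (auto simp: val_Suc mult_ac)
  qed auto
  show "card ?I \<le> gain (N div k)"
    using card_independent_le by (simp add: gain_def parity_region_def)
qed

section \<open>The asymptotics of the extremal count\<close>

text \<open>The discrete derivative of \<open>gain\<close> turns the sum over grids into a series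
  with fixed coefficients.\<close>

definition inc :: "nat \<Rightarrow> real" where
  "inc v = real (gain v) - real (gain (v - 1))"

lemma gain_0: "gain 0 = 0"
proof -
  have "region 0 = {}" using val_pos by (auto simp: region_def)
  then show ?thesis by (simp add: gain_def parity_region_def)
qed

lemma parity_region_mono: "Y \<le> Z \<Longrightarrow> parity_region b Y \<subseteq> parity_region b Z"
  using region_mono by (auto simp: parity_region_def)

lemma gain_mono: "Y \<le> Z \<Longrightarrow> gain Y \<le> gain Z"
  unfolding gain_def by (intro max.mono card_mono finite_parity_region parity_region_mono)

lemma inc_nonneg: "0 \<le> inc v"
  using gain_mono[of "v - 1" v] by (simp add: inc_def)

lemma val_inj: "val c = val c' \<Longrightarrow> c = c'"
  using core_val_unique[of 1 c 1 c'] p_gt_1 q_gt_1 by (simp add: core_def)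

text \<open>Since \<open>val\<close> is injective, raising the bound by one admits at most one new
  cell.\<close>

lemma inc_le_1: "inc v \<le> 1"
proof -
  have "card (parity_region b v) \<le> Suc (card (parity_region b (v - 1)))" for b
  proof -
    have "card (parity_region b v - parity_region b (v - 1)) \<le> card {v}"
    proof (rule card_inj_on_le[of val])
      show "inj_on val (parity_region b v - parity_region b (v - 1))"
        using val_inj unfolding inj_on_def by blast
      show "val ` (parity_region b v - parity_region b (v - 1)) \<subseteq> {v}"
        by (auto simp: parity_region_def region_def)
    qed simp
    moreover have "card (parity_region b v)
      = card (parity_region b (v - 1)) + card (parity_region b v - parity_region b (v - 1))"
      using parity_region_mono[of "v - 1" v b] finite_parity_region
      by (metis card_Diff_subset card_mono diff_le_self le_add_diff_inverse)
    ultimately show ?thesis by simp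
  qed
  from this[of True] this[of False] have "gain v \<le> Suc (gain (v - 1))"
    unfolding gain_def by linarith
  then show ?thesis by (simp add: inc_def)
qed

lemma gain_const:
  assumes "Y \<le> Z" and "\<And>c. val c \<notin> {Y<..Z}"
  shows "gain Y = gain Z"
proof -
  have "region Y = region Z" using assms by (force simp: region_def)
  then show ?thesis by (simp add: gain_def parity_region_def)
qed

lemma inc_eq_0: "v \<notin> range val \<Longrightarrow> inc v = 0"
proof -
  assume v: "v \<notin> range val"
  have "gain (v - 1) = gain v"
  proof (rule gain_const)
    fix c have "val c \<noteq> v" using v by blast
    then show "val c \<notin> {v - 1<..v}" by auto
  qed simp
  then show ?thesis by (simp add: inc_def)
qed

lemma gain_eq_sum_inc: "real (gain Z) = (\<Sum>v=1..Z. inc v)"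
  by (induction Z) (auto simp: gain_0 inc_def)

section \<open>Counting integers divisible by neither base, and passing to the limit\<close>

definition core_count :: "nat \<Rightarrow> nat" where
  "core_count Y = card (core \<inter> {..Y})"

lemma core_count_0: "core_count 0 = 0"
  using core_pos by (auto simp: core_count_def)

lemma core_count_le: "core_count Y \<le> Y"
proof -
  have "core \<inter> {..Y} \<subseteq> {1..Y}" using core_pos by force
  from card_mono[OF _ this] show ?thesis by (simp add: core_count_def)
qed

text \<open>Exchange of summation: each increment at \<open>v\<close> is collected once for every
  core \<open>k\<close> with \<open>k * v <= N\<close>.\<close>

lemma grid_total_eq_suminf: "real (grid_total N) = (\<Sum>v. inc v * real (core_count (N div v)))"
proof -
  have "real (grid_total N) = (\<Sum>k \<in> core \<inter> {..N}. \<Sum>v=1..N div k. inc v)"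
    by (simp add: grid_total_def gain_eq_sum_inc)
  also have "\<dots> = (\<Sum>k \<in> core \<inter> {..N}. \<Sum>v | v \<in> {1..N} \<and> k * v \<le> N. inc v)"
  proof (intro sum.cong refl)
    fix k assume "k \<in> core \<inter> {..N}"
    then have k: "0 < k" using core_pos by auto
    then have "k * v \<le> N \<Longrightarrow> v \<le> N" for v
      by (metis One_nat_def Suc_leI le_trans mult.commute mult_le_mono2 nat_mult_1_right)
    then show "{1..N div k} = {v. v \<in> {1..N} \<and> k * v \<le> N}"
      using k by (auto simp: less_eq_div_iff_mult_less_eq mult.commute)
  qed
  also have "\<dots> = (\<Sum>v=1..N. \<Sum>k | k \<in> core \<inter> {..N} \<and> k * v \<le> N. inc v)"
    by (rule sum.swap_restrict) auto
  also have "\<dots> = (\<Sum>v=1..N. inc v * real (core_count (N div v)))"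
  proof (intro sum.cong refl)
    fix v assume "v \<in> {1..N}"
    then have v: "0 < v" by simp
    have "k * v \<le> N \<Longrightarrow> k \<le> N" for k
      using v by (metis One_nat_def Suc_leI le_trans mult_le_mono2 nat_mult_1_right)
    then have "{k. k \<in> core \<inter> {..N} \<and> k * v \<le> N} = core \<inter> {..N div v}"
      using v by (auto simp: less_eq_div_iff_mult_less_eq)
    then show "(\<Sum>k | k \<in> core \<inter> {..N} \<and> k * v \<le> N. inc v) = inc v * real (core_count (N div v))"
      by (simp add: core_count_def)
  qed
  \<comment> \<open>The added terms vanish: \<open>N div v\<close> is 0 for \<open>v > N\<close>,
    and also for \<open>v = 0\<close> by convention.\<close>
  also have "\<dots> = (\<Sum>v. inc v * real (core_count (N div v)))"
    by (rule suminf_finite[symmetric]) (auto simp: core_count_0 not_le Suc_le_eq)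
  finally show ?thesis .
qed

text \<open>By coprimality this is the natural density of \<open>core\<close>.\<close>

definition core_density :: real where
  "core_density = (1 - 1 / real p) * (1 - 1 / real q)"

text \<open>Inclusion-exclusion, written additively to avoid truncated subtraction.\<close>

lemma core_count_eq: "core_count Y + Y div p + Y div q = Y + Y div (p * q)"
proof -
  let ?M = "\<lambda>r. {k \<in> {1..Y}. r dvd k}"
  have "?M (p * q) = ?M p \<inter> ?M q"
    using coprime by (auto intro: divides_mult dest: dvd_mult_left dvd_mult_right)
  moreover have "card (?M p \<union> ?M q) + card (?M p \<inter> ?M q) = card (?M p) + card (?M q)"
    by (rule card_Un_Int[symmetric]) auto
  moreover have "card {1..Y} = card (core \<inter> {..Y}) + card (?M p \<union> ?M q)"
  proof -
    have "{1..Y} = (core \<inter> {..Y}) \<union> (?M p \<union> ?M q)" using core_pos by (force simp: core_def)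
    also have "card \<dots> = card (core \<inter> {..Y}) + card (?M p \<union> ?M q)"
      by (rule card_Un_disjoint) (auto simp: core_def)
    finally show ?thesis .
  qed
  moreover have "card (?M p) = Y div p" "card (?M q) = Y div q" "card (?M (p * q)) = Y div (p * q)"
    using p_gt_1 q_gt_1 by (intro card_multiples; simp)+
  ultimately show ?thesis by (simp only: core_count_def card_atLeastAtMost)
qed

text \<open>Three floors err by at most 1 each, one with opposite sign, so the difference lies
  between -1 and 2.\<close>

lemma core_count_approx: "\<bar>real (core_count Y) - core_density * real Y\<bar> \<le> 2"
proof -
  have d: "real (Y div r) \<le> real Y / real r" "real Y / real r - 1 \<le> real (Y div r)" for r
    by (rule real_div_bounds)+
  have "core_density * real Y = real Y - real Y / real p - real Y / real q + real Y / real (p * q)"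
    using p_gt_1 q_gt_1 by (simp add: core_density_def field_simps)
  moreover have "real (core_count Y) = real Y - real (Y div p) - real (Y div q) + real (Y div (p * q))"
    using core_count_eq[of Y] by linarith
  ultimately show ?thesis
    using d[of p] d[of q] d[of "p * q"] by linarith
qed

lemma core_count_limit: "(\<lambda>N. real (core_count (N div v)) / real N) \<longlonglongrightarrow> core_density / real v"
\<comment> \<open>Index 0 belongs to the series; there both sides are 0 by the convention for
  division by zero.\<close>
proof (cases "v = 0")
  case True
  then show ?thesis by (simp add: core_count_0)
next
  case False
  have dens: "0 \<le> core_density" "core_density \<le> 1"
    using p_gt_1 q_gt_1 by (auto simp: core_density_def intro!: mult_le_one)
  \<comment> \<open>The 3 is the error 2 of \<open>core_count_approx\<close> plus at most 1 from
    rounding \<open>N / v\<close>.\<close>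
  have "\<bar>real (core_count (N div v)) / real N - core_density / real v\<bar> \<le> 3 / real N" if "N > 0" for N
  proof -
    have "\<bar>real (N div v) - real N / real v\<bar> \<le> 1"
      using real_div_bounds[of N v] by linarith
    then have "\<bar>core_density * real (N div v) - core_density * (real N / real v)\<bar> \<le> 1"
      unfolding right_diff_distrib[symmetric] abs_mult using dens by (intro mult_le_one) auto
    then have "\<bar>real (core_count (N div v)) - core_density * (real N / real v)\<bar> \<le> 3"
      using core_count_approx[of "N div v"] by linarith
    moreover have "real (core_count (N div v)) / real N - core_density / real v
        = (real (core_count (N div v)) - core_density * (real N / real v)) / real N"
      using that by (simp add: field_simps)
    ultimately show ?thesis using that by (simp add: divide_right_mono)
  qed
  then have "eventually (\<lambda>N. norm (real (core_count (N div v)) / real N - core_density / real v)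
      \<le> 3 / real N) sequentially"
    by (auto intro!: eventually_sequentiallyI[of 1])
  then have "(\<lambda>N. real (core_count (N div v)) / real N - core_density / real v) \<longlonglongrightarrow> 0"
    by (rule Lim_null_comparison) (rule lim_const_over_n)
  then show ?thesis by (rule LIM_zero_cancel)
qed

text \<open>Nonzero terms sit at values of cells and are at most \<open>1 / val c\<close>. Over a
  box these sum to a product of two geometric sums, each at most 2.\<close>

lemma summable_inc: "summable (\<lambda>v. inc v / real v)"
proof (rule summableI_nonneg_bounded)
  show "0 \<le> inc v / real v" for v using inc_nonneg by simp
  have geo: "(\<Sum>x\<le>n. 1 / real r ^ x) \<le> 2" if "1 < r" for r n :: nat
  proof -
    have "(\<Sum>x\<le>n. 1 / real r ^ x) \<le> (\<Sum>x\<le>n. (1 / 2) ^ x)"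
      using that by (intro sum_mono) (auto simp: power_divide intro!: divide_left_mono power_mono)
    also have "\<dots> \<le> (\<Sum>x. (1 / 2) ^ x)" by (intro sum_le_suminf summable_geometric) auto
    also have "\<dots> = 2" by (subst suminf_geometric) auto
    finally show ?thesis .
  qed
  fix n
  have "(\<Sum>v<n. inc v / real v) = (\<Sum>v \<in> {..<n} \<inter> range val. inc v / real v)"
    using inc_eq_0 by (intro sum.mono_neutral_right) auto
  also have "\<dots> \<le> (\<Sum>v \<in> {..<n} \<inter> range val. 1 / real v)"
    using inc_le_1 by (intro sum_mono divide_right_mono) auto
  also have "\<dots> \<le> (\<Sum>v \<in> val ` ({..n} \<times> {..n}). 1 / real v)"
  proof (rule sum_mono2)
    have "fst c \<le> n \<and> snd c \<le> n" if "val c < n" for c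
    proof -
      have "c \<in> region n" using that by (simp add: region_def)
      then show ?thesis using region_subset by force
    qed
    then show "{..<n} \<inter> range val \<subseteq> val ` ({..n} \<times> {..n})"
      by (fastforce simp: mem_Times_iff)
  qed auto
  also have "\<dots> \<le> (\<Sum>c \<in> {..n} \<times> {..n}. 1 / real (val c))"
    using sum_image_le[of "{..n} \<times> {..n}" "\<lambda>v. 1 / real v" val] by (simp add: o_def)
  also have "\<dots> = (\<Sum>x\<le>n. 1 / real p ^ x) * (\<Sum>y\<le>n. 1 / real q ^ y)"
    unfolding sum_product sum.cartesian_product by (simp add: val_def split_def)
  also have "\<dots> \<le> 2 * 2" by (intro mult_mono geo p_gt_1 q_gt_1 sum_nonneg) auto
  finally show "(\<Sum>v<n. inc v / real v) \<le> 4" by simp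
qed

definition weight :: real where
  "weight = (\<Sum>v. inc v / real v)"

text \<open>Tannery's theorem, dominated by \<open>inc v / v\<close> because
  \<open>core_count Y\<close> is at most \<open>Y\<close>.\<close>

lemma grid_total_limit: "(\<lambda>N. real (grid_total N) / real N) \<longlonglongrightarrow> core_density * weight"
proof -
  have lim: "(\<lambda>N. inc v * (real (core_count (N div v)) / real N)) \<longlonglongrightarrow> inc v * (core_density / real v)" for v
    by (intro tendsto_mult tendsto_const core_count_limit)
  have bound: "norm (inc v * (real (core_count (N div v)) / real N)) \<le> inc v / real v" for v N
  proof -
    have "real (core_count (N div v)) \<le> real N / real v"
      using core_count_le[of "N div v"] real_div_bounds(1)[of N v] by linarith
    then have "real (core_count (N div v)) / real N \<le> (real N / real v) / real N"
      by (rule divide_right_mono) simp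
    also have "\<dots> \<le> 1 / real v" by simp
    finally have "inc v * (real (core_count (N div v)) / real N) \<le> inc v * (1 / real v)"
      using inc_nonneg by (rule mult_left_mono)
    then show ?thesis using inc_nonneg[of v] by simp
  qed
  have "(\<lambda>N. \<Sum>v. inc v * (real (core_count (N div v)) / real N))
      \<longlonglongrightarrow> (\<Sum>v. inc v * (core_density / real v))"
    using tannery[OF lim bound summable_inc] .
  moreover have "(\<Sum>v. inc v * (real (core_count (N div v)) / real N)) = real (grid_total N) / real N" for N
  proof -
    have "summable (\<lambda>v. inc v * real (core_count (N div v)))"
      by (rule summable_finite[of "{..N}"]) (auto simp: core_count_0 not_le)
    from suminf_divide[OF this, of "real N"] show ?thesis by (simp add: grid_total_eq_suminf)
  qed
  moreover have "(\<Sum>v. inc v * (core_density / real v)) = core_density * weight"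
    using suminf_mult[OF summable_inc, of core_density] by (simp add: weight_def mult_ac)
  ultimately show ?thesis by simp
qed

text \<open>Serves to discard the boundary term of the summation by parts. In
  \<open>gain Z / Z\<close> each term \<open>inc v / Z\<close> has \<open>v <= Z\<close>, so it is
  dominated by \<open>inc v / v\<close>.\<close>

lemma gain_limit: "(\<lambda>Z. real (gain Z) / real Z) \<longlonglongrightarrow> 0"
proof -
  let ?a = "\<lambda>v Z. if v \<in> {1..Z} then inc v / real Z else 0"
  have lim: "(\<lambda>Z. ?a v Z) \<longlonglongrightarrow> 0" for v :: nat
  proof (rule Lim_null_comparison[OF _ lim_const_over_n])
    show "eventually (\<lambda>Z. norm (?a v Z) \<le> inc v / real Z) sequentially"
      using inc_nonneg[of v] by (auto intro!: always_eventually)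
  qed
  have bound: "norm (?a v Z) \<le> inc v / real v" for v Z
    using inc_nonneg[of v] by (auto intro!: divide_left_mono)
  have "(\<lambda>Z. \<Sum>v. ?a v Z) \<longlonglongrightarrow> (\<Sum>v. 0)"
    using tannery[where a = ?a, OF lim bound summable_inc] .
  moreover have "(\<Sum>v. ?a v Z) = real (gain Z) / real Z" for Z
    by (subst suminf_finite[of "{1..Z}"]) (auto simp: gain_eq_sum_inc sum_divide_distrib)
  ultimately show ?thesis by simp
qed

section \<open>The series over the enumerated semigroup\<close>

text \<open>Indexed from 0: \<open>m t\<close> is the element numbered \<open>Suc t\<close> in the
  series.\<close>

abbreviation m :: "nat \<Rightarrow> nat" where
  "m \<equiv> enumerate (range val)"

lemma power_products_eq: "power_products p q = range val"
  by (force simp: power_products_def val_def image_iff)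

lemma m_seq_Suc: "m_seq p q (Suc t) = m t"
  by (simp add: m_seq_def power_products_eq)

lemma infinite_range_val: "infinite (range val)"
proof -
  have "inj val" using val_inj by (rule injI)
  then show ?thesis by (simp add: finite_image_iff finite_prod)
qed

lemma strict_mono_m: "strict_mono m"
  using infinite_range_val by (simp add: strict_mono_def)

lemma val_eq_m: "\<exists>i. val c = m i"
  using enumerate_Ex[OF infinite_range_val, of "val c"] by (metis rangeI)

lemma m_0: "m 0 = 1"
proof -
  have "(LEAST n. n \<in> range val) = 1"
  proof (rule Least_equality)
    show "1 \<in> range val" by (rule image_eqI[of _ _ "(0, 0)"]) (simp_all add: val_def)
    show "1 \<le> n" if "n \<in> range val" for n using that val_pos by (auto simp: Suc_le_eq)
  qed
  then show ?thesis by (simp add: enumerate_0)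
qed

lemma m_pos: "0 < m t"
  using m_0 strict_mono_less_eq[OF strict_mono_m, of 0 t] by simp

text \<open>As the enumeration increases, its first \<open>Suc t\<close> elements are those of value
  at most \<open>m t\<close>.\<close>

lemma parity_class_eq: "parity_class p q j (Suc t) = val ` parity_region (even j) (m t)"
proof (intro set_eqI iffI)
  have cong: "[x + y = j] (mod 2) \<longleftrightarrow> even (x + y) = even j" for x y :: nat
    unfolding Cong.cong_def by presburger
  {
    fix v assume "v \<in> parity_class p q j (Suc t)"
    then obtain i x y where i: "v = m_seq p q i" "1 \<le> i" "i \<le> Suc t"
      and xy: "m_seq p q i = p ^ x * q ^ y" "[x + y = j] (mod 2)"
      unfolding parity_class_def by blast
    then obtain i' where "i = Suc i'" by (cases i) auto
    then have "v \<le> m t" using i strict_mono_less_eq[OF strict_mono_m] by (simp add: m_seq_Suc)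
    moreover have "v = val (x, y)" using i xy by (simp add: val_def)
    ultimately have "(x, y) \<in> parity_region (even j) (m t)"
      using cong xy by (simp add: parity_region_def region_def)
    then show "v \<in> val ` parity_region (even j) (m t)" using \<open>v = val (x, y)\<close> by blast
  next
    fix v assume "v \<in> val ` parity_region (even j) (m t)"
    then obtain x y where v: "v = val (x, y)" "val (x, y) \<le> m t" "even (x + y) = even j"
      by (auto simp: parity_region_def region_def simp del: even_add)
    obtain i where i: "val (x, y) = m i" using val_eq_m by blast
    have "m_seq p q (Suc i) = p ^ x * q ^ y \<and> [x + y = j] (mod 2)"
      using v cong i by (simp add: m_seq_Suc val_def)
    moreover have "Suc i \<le> Suc t" using v i strict_mono_less_eq[OF strict_mono_m] by simp
    moreover have "v = m_seq p q (Suc i)" using v i by (simp add: m_seq_Suc)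
    ultimately show "v \<in> parity_class p q j (Suc t)"
      unfolding parity_class_def by (intro CollectI exI[of _ "Suc i"]) (simp, blast)
  }
qed

lemma card_parity_class: "card (parity_class p q j (Suc t)) = card (parity_region (even j) (m t))"
  unfolding parity_class_eq using val_inj by (intro card_image) (auto simp: inj_on_def)

lemma gain_before_m: "gain (m (Suc t) - 1) = gain (m t)"
proof (rule gain_const[symmetric])
  show "m t \<le> m (Suc t) - 1"
    using strict_mono_less[OF strict_mono_m, of t "Suc t"] by simp
  fix c
  obtain i where "val c = m i" using val_eq_m by blast
  then show "val c \<notin> {m t<..m (Suc t) - 1}"
    using strict_mono_less[OF strict_mono_m, of t i] strict_mono_less[OF strict_mono_m, of i "Suc t"]
      m_pos[of "Suc t"] by auto
qed

text \<open>Summation by parts; \<^const>\<open>inc\<close> vanishes between consecutive elements.\<close>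

lemma partial_sums:
  "(\<Sum>t<T. real (gain (m t)) * (1 / real (m t) - 1 / real (m (Suc t))))
    = (\<Sum>v<m T. inc v / real v) - real (gain (m T - 1)) / real (m T)"
proof (induction T)
  case 0
  \<comment> \<open>As \<open>m 0 = 1\<close>, the sum has only the index 0, where division by zero
    gives 0.\<close>
  then show ?case by (simp add: m_0 gain_0)
next
  case (Suc T)
  have less: "m T < m (Suc T)" using strict_mono_m by (simp add: strict_mono_def)
  have "(\<Sum>v \<in> {m T..<m (Suc T)}. inc v / real v) = (\<Sum>v \<in> {m T}. inc v / real v)"
  proof (rule sum.mono_neutral_right)
    show "\<forall>v \<in> {m T..<m (Suc T)} - {m T}. inc v / real v = 0"
    proof
      fix v assume v: "v \<in> {m T..<m (Suc T)} - {m T}"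
      have "v \<noteq> val c" for c
      proof
        assume "v = val c"
        then obtain i where "v = m i" using val_eq_m by metis
        then show False using v strict_mono_less[OF strict_mono_m, of T i]
            strict_mono_less[OF strict_mono_m, of i "Suc T"] by auto
      qed
      then have "v \<notin> range val" by blast
      then show "inc v / real v = 0" using inc_eq_0 by simp
    qed
  qed (use less in auto)
  moreover have "{..<m (Suc T)} = {..<m T} \<union> {m T..<m (Suc T)}" using less by auto
  then have "(\<Sum>v<m (Suc T). inc v / real v)
      = (\<Sum>v<m T. inc v / real v) + (\<Sum>v \<in> {m T..<m (Suc T)}. inc v / real v)"
    by (metis (no_types, lifting) finite_atLeastLessThan finite_lessThan ivl_disj_int_one(2)
        sum.union_disjoint)
  ultimately have "(\<Sum>v<m (Suc T). inc v / real v) = (\<Sum>v<m T. inc v / real v) + inc (m T) / real (m T)"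
    by simp
  then show ?case
    using Suc.IH by (simp add: gain_before_m[unfolded One_nat_def] inc_def[of "m T"] diff_divide_distrib right_diff_distrib)
qed

lemma sums_weight:
  "(\<lambda>t. real (gain (m t)) * (1 / real (m t) - 1 / real (m (Suc t)))) sums weight"
proof -
  have m: "filterlim m sequentially sequentially" using strict_mono_m by (rule filterlim_subseq)
  have "(\<lambda>T. \<Sum>v<m T. inc v / real v) \<longlonglongrightarrow> weight"
    unfolding weight_def by (rule filterlim_compose[OF summable_LIMSEQ[OF summable_inc] m])
  moreover have "(\<lambda>T. real (gain (m T - 1)) / real (m T)) \<longlonglongrightarrow> 0"
  proof (rule Lim_null_comparison[OF _ filterlim_compose[OF gain_limit m]])
    show "\<forall>\<^sub>F T in sequentially. norm (real (gain (m T - 1)) / real (m T)) \<le> real (gain (m T)) / real (m T)"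
      using gain_mono by (auto intro!: always_eventually divide_right_mono)
  qed
  ultimately have "(\<lambda>T. (\<Sum>v<m T. inc v / real v) - real (gain (m T - 1)) / real (m T)) \<longlonglongrightarrow> weight - 0"
    by (rule tendsto_diff)
  then show ?thesis unfolding sums_def partial_sums by simp
qed

lemma upper_sigma_eq: "upper_sigma p q = ereal (core_density * weight)"
proof -
  have "(\<Sum>t. ereal (real (gain (m t)) * (1 / real (m t) - 1 / real (m (Suc t))))) = ereal weight"
    by (rule sums_unique[symmetric]) (use sums_weight in \<open>simp add: sums_ereal\<close>)
  then show ?thesis
    by (simp add: upper_sigma_def m_seq_Suc card_parity_class gain_def core_density_def)
qed

section \<open>Density of quotient-free sets\<close>

lemma Int_initial_segment:
  assumes "0 \<le> X"
  shows "S \<inter> initial_segment X = S \<inter> {1..nat \<lfloor>X\<rfloor>}"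
  using assms by (auto simp: initial_segment_def le_nat_iff le_floor_iff)

text \<open>Rounding \<open>X\<close> down keeps the count and shrinks the denominator, so the limit
  along integers suffices.\<close>

lemma upper_density_le:
  assumes "quotient_free {p, q} S"
  shows "upper_density S \<le> ereal (core_density * weight)"
proof -
  let ?N = "\<lambda>X::real. nat \<lfloor>X\<rfloor>"
  have "upper_density S \<le> Limsup at_top (\<lambda>X. ereal (real (grid_total (?N X)) / real (?N X)))"
    unfolding upper_density_def
  proof (rule Limsup_mono, rule eventually_at_top_linorderI)
    fix X :: real assume X: "1 \<le> X"
    then have N: "0 < real (?N X)" "real (?N X) \<le> X" by simp_all
    have "real (card (S \<inter> initial_segment X)) / X \<le> real (grid_total (?N X)) / real (?N X)"
      using card_quotient_free_le[OF assms, of "?N X"] N X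
      by (intro frac_le) (auto simp: Int_initial_segment)
    then show "ereal (real (card (S \<inter> initial_segment X)) / X)
        \<le> ereal (real (grid_total (?N X)) / real (?N X))" by simp
  qed
  also have "\<dots> = ereal (core_density * weight)"
  proof (rule lim_imp_Limsup)
    have "filterlim ?N sequentially at_top"
      by (rule filterlim_compose[OF filterlim_nat_sequentially filterlim_floor_sequentially])
    then show "((\<lambda>X. ereal (real (grid_total (?N X)) / real (?N X))) \<longlongrightarrow> ereal (core_density * weight)) at_top"
      by (intro tendsto_ereal filterlim_compose[OF grid_total_limit])
  qed simp
  finally show ?thesis .
qed

section \<open>Construction of an extremal set\<close>

text \<open>Inside each block \<open>(q n!, (n+1)!]\<close> the extremal set takes, on every grid, the parity class
  that is larger up to \<open>(n+1)!\<close>. The gap \<open>(n!, q n!]\<close> decouples consecutive blocks.\<close>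

definition better :: "nat \<Rightarrow> bool" where
  "better Z \<longleftrightarrow> card (parity_region False Z) \<le> card (parity_region True Z)"

lemma card_better: "card (parity_region (better Z) Z) = gain Z"
  by (cases "better Z") (simp_all add: better_def gain_def)

definition optimal :: "nat \<Rightarrow> nat set" where
  "optimal N = {k * val c | k c. k \<in> core \<and> c \<in> parity_region (better (N div k)) (N div k)}"

definition extremal_set :: "nat set" where
  "extremal_set = (\<Union>n. optimal (fact (Suc n)) \<inter> {q * fact n<..})"

lemma optimal_iff:
  "k \<in> core \<Longrightarrow> k * val c \<in> optimal N \<longleftrightarrow> c \<in> parity_region (better (N div k)) (N div k)"
proof
  assume k: "k \<in> core" and "k * val c \<in> optimal N"
  then obtain k' c' where "k * val c = k' * val c'" "k' \<in> core"
    "c' \<in> parity_region (better (N div k')) (N div k')"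
    unfolding optimal_def by blast
  then show "c \<in> parity_region (better (N div k)) (N div k)"
    using core_val_unique[of k c k' c'] k by simp
next
  assume "k \<in> core" and "c \<in> parity_region (better (N div k)) (N div k)"
  then show "k * val c \<in> optimal N" unfolding optimal_def by blast
qed

lemma optimal_le: "optimal N \<subseteq> {1..N}"
proof
  fix v assume "v \<in> optimal N"
  then obtain k c where "v = k * val c" "k \<in> core" "val c \<le> N div k"
    by (auto simp: optimal_def parity_region_def region_def)
  then show "v \<in> {1..N}"
    using core_pos[of k] val_pos[of c] by (auto simp: less_eq_div_iff_mult_less_eq mult.commute)
qed

text \<open>Every grid contributes its larger parity class, so the bound of
  \<open>card_quotient_free_le\<close> is attained.\<close>

lemma card_optimal: "card (optimal N) = grid_total N"
proof -
  have "card (optimal N) = card (optimal N \<inter> {1..N})" using optimal_le by (simp add: Int_absorb2)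
  also have "\<dots> = (\<Sum>k \<in> core \<inter> {..N}. card (parity_region (better (N div k)) (N div k)))"
    unfolding card_by_grids
    by (intro sum.cong refl arg_cong[where f = card]) (auto simp: optimal_iff parity_region_def)
  finally show ?thesis by (simp add: card_better grid_total_def)
qed

text \<open>Multiplying by \<open>p\<close> or \<open>q\<close> stays on the same grid and flips the
  parity.\<close>

lemma optimal_quotient_free:
  assumes "v \<in> optimal N"
  shows "p * v \<notin> optimal N" and "q * v \<notin> optimal N"
proof -
  obtain k x y where v: "v = k * val (x, y)" "k \<in> core"
    "(x, y) \<in> parity_region (better (N div k)) (N div k)"
    using assms by (auto simp: optimal_def)
  have "p * v = k * val (Suc x, y)" "q * v = k * val (x, Suc y)" using v by (simp_all add: val_Suc)
  then show "p * v \<notin> optimal N" "q * v \<notin> optimal N"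
    using v by (simp_all only: optimal_iff) (auto simp: parity_region_def)
qed

text \<open>Reduces quotient-freeness of the union to a single \<open>optimal N\<close>: a factor of
  at most \<open>q\<close> cannot cross the gap to a later block, and a factor of at least 1 cannot
  lead to an earlier one.\<close>

lemma extremal_set_scaled:
  assumes v: "v \<in> extremal_set" and rv: "r * v \<in> extremal_set" and r: "0 < r" "r \<le> q"
  shows "\<exists>N. v \<in> optimal N \<and> r * v \<in> optimal N"
proof -
  obtain n where n: "v \<in> optimal (fact (Suc n))" "q * fact n < v" using v by (auto simp: extremal_set_def)
  obtain n' where n': "r * v \<in> optimal (fact (Suc n'))" "q * fact n' < r * v"
    using rv by (auto simp: extremal_set_def)
  have le: "v \<le> fact (Suc n)" "r * v \<le> fact (Suc n')" using n n' optimal_le by fastforce+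
  have "\<not> n < n'"
  proof
    assume "n < n'"
    then have "(fact (Suc n) :: nat) \<le> fact n'" by (intro fact_mono_nat) simp
    then have "r * v \<le> q * fact n'" using le r by (intro mult_le_mono) auto
    then show False using n' by simp
  qed
  moreover have "\<not> n' < n"
  proof
    assume "n' < n"
    then have "(fact (Suc n') :: nat) \<le> fact n" by (intro fact_mono_nat) simp
    moreover have "v \<le> r * v" using r by simp
    moreover have "fact n \<le> q * fact n" using q_gt_1 by simp
    ultimately show False using n le by linarith
  qed
  ultimately have "n = n'" by simp
  then show ?thesis using n n' by blast
qed

lemma quotient_free_extremal_set: "quotient_free {p, q} extremal_set"
proof -
  have pos: "0 < v" if "v \<in> extremal_set" for v
    using that optimal_le by (fastforce simp: extremal_set_def)
  have "real x / real y \<noteq> real r" if xy: "x \<in> extremal_set" "y \<in> extremal_set" and r: "r \<in> {p, q}" for x y r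
  proof
    assume "real x / real y = real r"
    then have "real x = real (r * y)" using pos[OF xy(2)] by (simp add: field_simps)
    then have x: "x = r * y" by (simp only: of_nat_eq_iff)
    have "0 < r" "r \<le> q" using r p_gt_1 p_less_q by auto
    then obtain N where "y \<in> optimal N" "r * y \<in> optimal N"
      using extremal_set_scaled[of y r] xy unfolding x by blast
    then show False using optimal_quotient_free r by auto
  qed
  then show ?thesis using pos unfolding quotient_free_def by (metis imageE)
qed

text \<open>Up to \<open>(n+1)!\<close>, the extremal set can lose members of the optimal set only
  below the start of the block.\<close>

lemma card_extremal_set_ge:
  "grid_total (fact (Suc n)) \<le> card (extremal_set \<inter> {1..fact (Suc n)}) + q * fact n"
proof -
  have "optimal (fact (Suc n)) \<subseteq> (extremal_set \<inter> {1..fact (Suc n)}) \<union> {1..q * fact n}"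
  proof
    fix v assume v: "v \<in> optimal (fact (Suc n))"
    then have "v \<in> {1..fact (Suc n)}" using optimal_le by blast
    moreover have "v \<in> extremal_set" if "q * fact n < v"
      using v that unfolding extremal_set_def by blast
    ultimately show "v \<in> (extremal_set \<inter> {1..fact (Suc n)}) \<union> {1..q * fact n}" by force
  qed
  then have "grid_total (fact (Suc n)) \<le> card ((extremal_set \<inter> {1..fact (Suc n)}) \<union> {1..q * fact n})"
    unfolding card_optimal[symmetric] by (intro card_mono) auto
  also have "\<dots> \<le> card (extremal_set \<inter> {1..fact (Suc n)}) + card {1..q * fact n}" by (rule card_Un_le)
  finally show ?thesis by simp
qed

lemma upper_density_extremal_set: "ereal (core_density * weight) \<le> upper_density extremal_set"
proof -
  let ?g = "\<lambda>X::real. ereal (real (card (extremal_set \<inter> initial_segment X)) / X)"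
  \<comment> \<open>The correction is the discarded share \<open>q * n! / (n+1)!\<close>.\<close>
  let ?h = "\<lambda>n. real (grid_total (fact (Suc n))) / real (fact (Suc n)) - real q / real (Suc n)"
  have fact_lim: "filterlim (\<lambda>n. fact (Suc n) :: nat) sequentially sequentially"
    by (rule filterlim_subseq) (simp add: strict_mono_Suc_iff del: of_nat_fact)
  have "(\<lambda>n. real q / real (Suc n)) \<longlonglongrightarrow> 0"
    using LIMSEQ_Suc[OF lim_const_over_n[of "real q"]] by simp
  then have "?h \<longlonglongrightarrow> core_density * weight - 0"
    by (intro tendsto_diff filterlim_compose[OF grid_total_limit fact_lim])
  then have "ereal (core_density * weight) = Limsup sequentially (\<lambda>n. ereal (?h n))"
    by (intro lim_imp_Limsup[symmetric] tendsto_ereal) simp_all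
  also have "\<dots> \<le> Limsup sequentially (\<lambda>n. ?g (real (fact (Suc n))))"
  proof (rule Limsup_mono, rule always_eventually, rule allI)
    fix n
    let ?F = "fact (Suc n) :: nat"
    have "real (grid_total ?F) - real (q * fact n) \<le> real (card (extremal_set \<inter> {1..?F}))"
      using card_extremal_set_ge[of n] by linarith
    then have "(real (grid_total ?F) - real (q * fact n)) / real ?F
        \<le> real (card (extremal_set \<inter> {1..?F})) / real ?F"
      by (rule divide_right_mono) simp
    moreover have "real (q * fact n) / real ?F = real q / real (Suc n)"
      unfolding fact_Suc of_nat_mult of_nat_id by (rule nonzero_mult_divide_mult_cancel_right) simp
    moreover have "extremal_set \<inter> initial_segment (real ?F) = extremal_set \<inter> {1..?F}"
      using Int_initial_segment[of "real ?F"] by (simp del: fact_Suc of_nat_fact)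
    ultimately show "ereal (?h n) \<le> ?g (real (fact (Suc n)))"
      by (simp add: diff_divide_distrib del: fact_Suc of_nat_fact)
  qed
  also have "\<dots> \<le> Limsup (filtermap (\<lambda>n. real (fact (Suc n))) sequentially) ?g"
    by (rule Limsup_filtermap_ge)
  \<comment> \<open>The factorials tend to infinity, so the upper limit along them is at most the
    full one.\<close>
  also have "\<dots> \<le> Limsup at_top ?g"
  proof -
    have "filterlim (\<lambda>n. real (fact (Suc n))) at_top sequentially"
      by (rule filterlim_compose[OF filterlim_real_sequentially fact_lim])
    then show ?thesis
      unfolding Limsup_def by (intro INF_superset_mono) (auto simp: filterlim_def le_filter_def)
  qed
  finally show ?thesis unfolding upper_density_def .
qed

lemma upper_rho_eq: "upper_rho {p, q} = ereal (core_density * weight)"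
  unfolding upper_rho_def
proof (rule antisym)
  show "(SUP S \<in> {S. quotient_free {p, q} S}. upper_density S) \<le> ereal (core_density * weight)"
    using upper_density_le by (intro SUP_least) simp
  show "ereal (core_density * weight) \<le> (SUP S \<in> {S. quotient_free {p, q} S}. upper_density S)"
    using quotient_free_extremal_set upper_density_extremal_set by (intro SUP_upper2) simp_all
qed

end

theorem theorem5:
  fixes p q :: nat
  assumes "1 < p" and "p < q" and "gcd p q = 1"
  shows "upper_rho {p, q} = upper_sigma p q"
proof -
  interpret coprime_bases p q
    using assms by unfold_locales (simp_all add: coprime_iff_gcd_eq_1)
  show ?thesis by (simp only: upper_rho_eq upper_sigma_eq)
qed

end
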